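(* $\mathbf{L}_2$ is an interior image of any non-trivial interval in $\mathbf{R}$; that is, for every non-trivial interval $I\subseteq\mathbf{R}$ there is an onto interior map $I\to\mathbf{L}_2$.
   Context: $T_2$ is the set of finite $\{0,1\}$-valued sequences (including the empty one), and $L_2$ is $T_2$ together with all infinite sequences $\omega\to\{0,1\}$, ordered by $a\le b$ iff $a$ is an initial segment of $b$. This order is a directed complete partial order; $\mathbf{L}_2$ denotes $L_2$ with the Scott topology, for which $\{\uparrow a: a\in T_2\}$ is a basis, where $\uparrow a=\{b\in L_2: a\le b\}$. A map between topological spaces is interior if it is continuous and open. Intervals (open, closed, or half-open; bounded or not; non-trivial means containing more than one point) carry the subspace topology from the usual topology of $\mathbf{R}$. *)

theory Defs
  imports "HOL-Analysis.Analysis" "HOL-Library.Sublist" "HOL-Library.Lub_Glb"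
begin

section \<open>Scott topology and interior maps\<close>

definition directed :: "'a::order set \<Rightarrow> bool" where
  "directed D \<longleftrightarrow> D \<noteq> {} \<and> (\<forall>x\<in>D. \<forall>y\<in>D. \<exists>z\<in>D. x \<le> z \<and> y \<le> z)"

definition scott_open :: "'a::order set \<Rightarrow> bool" where
  "scott_open U \<longleftrightarrow>
     (\<forall>x\<in>U. \<forall>y. x \<le> y \<longrightarrow> y \<in> U) \<and>
     (\<forall>D x. directed D \<and> isLub UNIV D x \<and> x \<in> U \<longrightarrow> D \<inter> U \<noteq> {})"

definition scott_topology :: "'a::order topology" where
  "scott_topology = topology scott_open"

definition interior_map :: "'a topology \<Rightarrow> 'b topology \<Rightarrow> ('a \<Rightarrow> 'b) \<Rightarrow> bool" where
  "interior_map X Y f \<longleftrightarrow> continuous_map X Y f \<and> open_map X Y f"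

lemma istopology_scott_open: "istopology (scott_open :: 'a::order set \<Rightarrow> bool)"
proof -
  have up: "y \<in> S" if "scott_open S" "x \<in> S" "x \<le> y" for S :: "'a set" and x y
    using that unfolding scott_open_def by blast
  have meet: "\<exists>d. d \<in> D \<and> d \<in> S"
    if "scott_open S" "directed D" "isLub UNIV D x" "x \<in> S" for S D :: "'a set" and x
  proof -
    have "D \<inter> S \<noteq> {}" using that(1)[unfolded scott_open_def, THEN conjunct2] that(2-4) by blast
    then show ?thesis by blast
  qed
  have "scott_open (S \<inter> T)" if S: "scott_open S" and T: "scott_open T" for S T :: "'a set"
    unfolding scott_open_def
  proof (intro conjI ballI allI impI; (elim conjE)?)
    fix x y assume "x \<in> S \<inter> T" "x \<le> y"
    then show "y \<in> S \<inter> T" using up[OF S, of x y] up[OF T, of x y] by simp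
  next
    fix D x assume D: "directed D" "isLub UNIV D x" "x \<in> S \<inter> T"
    obtain a where a: "a \<in> D" "a \<in> S" using meet[OF S D(1,2)] D(3) by auto
    obtain b where b: "b \<in> D" "b \<in> T" using meet[OF T D(1,2)] D(3) by auto
    obtain c where c: "c \<in> D" "a \<le> c" "b \<le> c"
      using D(1) a(1) b(1) unfolding directed_def by meson
    have "c \<in> S" "c \<in> T" using up[OF S a(2) c(2)] up[OF T b(2) c(3)] by auto
    with c(1) show "D \<inter> (S \<inter> T) \<noteq> {}" by blast
  qed
  moreover have "scott_open (\<Union>K)" if K: "\<forall>S\<in>K. scott_open S" for K :: "'a set set"
    unfolding scott_open_def
  proof (intro conjI ballI allI impI; (elim conjE)?)
    fix x y assume "x \<in> \<Union>K" "x \<le> y"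
    then show "y \<in> \<Union>K" using up K by (meson Union_iff)
  next
    fix D x assume D: "directed D" "isLub UNIV D x" "x \<in> \<Union>K"
    then obtain S where S: "S \<in> K" "x \<in> S" by blast
    then obtain d where "d \<in> D" "d \<in> S" using meet[OF _ D(1,2)] K by blast
    with S show "D \<inter> \<Union>K \<noteq> {}" by blast
  qed
  ultimately show ?thesis unfolding istopology_def by blast
qed

lemma openin_scott_topology [simp]: "openin scott_topology U \<longleftrightarrow> scott_open U"
  by (simp add: scott_topology_def istopology_scott_open)

lemma topspace_scott_topology [simp]: "topspace scott_topology = UNIV"
proof -
  have "scott_open (UNIV :: 'a set)"
    by (auto simp: scott_open_def directed_def)
  then show ?thesis
    using openin_subset openin_scott_topology by blast
qed


section \<open>Finite and infinite binary sequences\<close>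

text \<open>The digits 0 and 1 are represented by the two elements of \<^typ>\<open>bool\<close>.\<close>

datatype L\<^sub>2 = Finseq "bool list" | Infseq "nat \<Rightarrow> bool"

definition T\<^sub>2 :: "L\<^sub>2 set" where
  "T\<^sub>2 = range Finseq"

instantiation L\<^sub>2 :: order
begin

fun less_eq_L\<^sub>2 :: "L\<^sub>2 \<Rightarrow> L\<^sub>2 \<Rightarrow> bool" where
  "Finseq s \<le> Finseq t \<longleftrightarrow> prefix s t"
| "Finseq s \<le> Infseq g \<longleftrightarrow> (\<forall>i<length s. s ! i = g i)"
| "Infseq f \<le> Finseq t \<longleftrightarrow> False"
| "Infseq f \<le> Infseq g \<longleftrightarrow> f = g"

definition less_L\<^sub>2 :: "L\<^sub>2 \<Rightarrow> L\<^sub>2 \<Rightarrow> bool" where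
  "less_L\<^sub>2 a b \<longleftrightarrow> a \<le> b \<and> \<not> b \<le> a"

instance
proof
  fix x y z :: L\<^sub>2
  show "(x < y) = (x \<le> y \<and> \<not> y \<le> x)" by (simp add: less_L\<^sub>2_def)
  show "x \<le> x" by (cases x) auto
  show "x \<le> y \<Longrightarrow> y \<le> z \<Longrightarrow> x \<le> z"
    by (cases x; cases y; cases z) (auto simp: prefix_def nth_append, (metis trans_less_add1)+)
  show "x \<le> y \<Longrightarrow> y \<le> x \<Longrightarrow> x = y"
    by (cases x; cases y) auto
qed

end

lemma Infseq_le_iff: "Infseq f \<le> b \<longleftrightarrow> b = Infseq f"
  by (cases b) auto

lemma Finseq_le_Finseq_of_length:
  assumes "Finseq s \<le> x" "Finseq t \<le> x" "length s \<le> length t"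
  shows "Finseq s \<le> Finseq t"
proof (cases x)
  case (Finseq u)
  with assms show ?thesis
    using prefix_length_prefix by auto
next
  case (Infseq g)
  with assms have "s = take (length s) t"
    by (auto intro!: nth_equalityI)
  then show ?thesis
    by (metis less_eq_L\<^sub>2.simps(1) take_is_prefix)
qed

lemma isLub_iff:
  "isLub UNIV D (x::'a::order) \<longleftrightarrow> (\<forall>d\<in>D. d \<le> x) \<and> (\<forall>u. (\<forall>d\<in>D. d \<le> u) \<longrightarrow> x \<le> u)"
  by (auto simp: isLub_def leastP_def isUb_def setle_def setge_def)

lemma isLub_initial_segments:
  assumes "D \<subseteq> T\<^sub>2" "\<And>d. d \<in> D \<Longrightarrow> d \<le> Infseq g" "\<And>n. \<exists>s. Finseq s \<in> D \<and> n < length s"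
  shows "isLub UNIV D (Infseq g)"
  unfolding isLub_iff
proof (intro conjI ballI allI impI)
  fix u assume u: "\<forall>d\<in>D. d \<le> u"
  show "Infseq g \<le> u"
  proof (cases u)
    case (Finseq t)
    obtain s where "Finseq s \<in> D" "length t < length s" using assms(3) by blast
    with u Finseq show ?thesis
      by (metis less_eq_L\<^sub>2.simps(1) not_less prefix_length_le)
  next
    case (Infseq h)
    have "g n = h n" for n
    proof -
      obtain s where "Finseq s \<in> D" "n < length s" using assms(3) by blast
      with u Infseq assms(2) show ?thesis
        by (metis less_eq_L\<^sub>2.simps(2))
    qed
    with Infseq show ?thesis by auto
  qed
qed (use assms(2) in auto)

lemma L\<^sub>2_directed_complete:
  assumes "directed (D :: L\<^sub>2 set)"
  shows "\<exists>x. isLub UNIV D x"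
proof (cases "\<exists>m\<in>D. \<forall>d\<in>D. d \<le> m")
  case True
  then show ?thesis by (auto simp: isLub_iff)
next
  case nomax: False
  have up: "\<exists>z\<in>D. x \<le> z \<and> y \<le> z" if "x \<in> D" "y \<in> D" for x y
    using assms that unfolding directed_def by blast
  have "Infseq f \<notin> D" for f
    using nomax up Infseq_le_iff by metis
  then have fin: "D \<subseteq> T\<^sub>2"
    unfolding T\<^sub>2_def by (metis L\<^sub>2.exhaust rangeI subsetI)
  have long: "\<exists>s. Finseq s \<in> D \<and> n \<le> length s" for n
  proof (induction n)
    case 0
    then show ?case using assms fin by (auto simp: directed_def T\<^sub>2_def)
  next
    case (Suc n)
    then obtain s where s: "Finseq s \<in> D" "n \<le> length s" by blast
    with nomax obtain d where d: "d \<in> D" "\<not> d \<le> Finseq s" by blast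
    with up s obtain z where z: "z \<in> D" "Finseq s \<le> z" "d \<le> z" by metis
    obtain t where t: "z = Finseq t" using z fin by (auto simp: T\<^sub>2_def)
    have "strict_prefix s t"
      using z d t by (auto simp: strict_prefix_def)
    then have "Suc n \<le> length t" using s prefix_length_less by fastforce
    with z t show ?case by blast
  qed
  define g where "g n = (SOME s. Finseq s \<in> D \<and> n < length s) ! n" for n
  have "s ! n = g n" if s: "Finseq s \<in> D" "n < length s" for s n
  proof -
    define t where "t = (SOME s. Finseq s \<in> D \<and> n < length s)"
    have t: "Finseq t \<in> D" "n < length t"
      using someI[of "\<lambda>s. Finseq s \<in> D \<and> n < length s", OF conjI[OF s]] by (auto simp: t_def)
    obtain z where z: "z \<in> D" "Finseq s \<le> z" "Finseq t \<le> z" using up[OF s(1) t(1)] by blast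
    obtain u where "z = Finseq u" using z fin by (auto simp: T\<^sub>2_def)
    with z have "prefix s u" "prefix t u" by simp_all
    then obtain v w where "u = s @ v" "u = t @ w" unfolding prefix_def by blast
    with s t have "s ! n = t ! n" by (metis nth_append)
    then show ?thesis by (simp add: g_def t_def)
  qed
  then have "d \<le> Infseq g" if "d \<in> D" for d
    using that fin by (auto simp: T\<^sub>2_def)
  then have "isLub UNIV D (Infseq g)"
    using fin long by (intro isLub_initial_segments) (auto simp: Suc_le_eq[symmetric])
  then show ?thesis ..
qed

lemma scott_open_up:
  assumes "a \<in> T\<^sub>2"
  shows "scott_open {a..}"
proof -
  obtain s where s: "a = Finseq s" using assms by (auto simp: T\<^sub>2_def)
  have "D \<inter> {Finseq s..} \<noteq> {}" if D: "directed D" and x: "isLub UNIV D x" "Finseq s \<le> x" for D x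
  proof (rule ccontr)
    assume "\<not> ?thesis"
    then have no: "\<not> Finseq s \<le> d" if "d \<in> D" for d using that by blast
    have ub: "d \<le> x" if "d \<in> D" for d using x that by (simp add: isLub_iff)
    have fin: "\<exists>t. d = Finseq t \<and> length t < length s" if "d \<in> D" for d
    proof (cases d)
      case (Finseq t)
      with no ub that x show ?thesis
        using Finseq_le_Finseq_of_length[of s x t] by (metis not_le)
    next
      case (Infseq f)
      with ub[OF that] have "x = d" by (simp add: Infseq_le_iff)
      with x no that show ?thesis by blast
    qed
    define P where "P n \<longleftrightarrow> (\<exists>t. Finseq t \<in> D \<and> length t = n)" for n
    have "\<exists>n. P n" using D fin unfolding directed_def P_def by blast
    moreover have "n \<le> length s" if "P n" for n using fin that unfolding P_def by fastforce
    ultimately obtain n where "P n" and max: "\<And>m. P m \<Longrightarrow> m \<le> n"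
      by (metis GreatestI_ex_nat Greatest_le_nat)
    then obtain t where t: "Finseq t \<in> D" "length t = n" unfolding P_def by blast
    have "d \<le> Finseq t" if d: "d \<in> D" for d
    proof -
      obtain u where u: "d = Finseq u" using fin[OF d] by blast
      with d max t have "length u \<le> length t" unfolding P_def by blast
      with u d t ub Finseq_le_Finseq_of_length show ?thesis by blast
    qed
    then have "x \<le> Finseq t" using x by (simp add: isLub_iff)
    with x no t show False using order_trans by blast
  qed
  then show ?thesis
    unfolding scott_open_def s using order_trans by auto
qed

lemma scott_open_basis:
  "scott_open U \<longleftrightarrow> (\<exists>S\<subseteq>T\<^sub>2. U = (\<Union>a\<in>S. {a..}))"
proof
  assume U: "scott_open U"
  have "\<exists>a\<in>U \<inter> T\<^sub>2. a \<le> x" if "x \<in> U" for x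
  proof (cases x)
    case (Finseq s)
    with that show ?thesis by (auto simp: T\<^sub>2_def)
  next
    case (Infseq g)
    define D where "D = range (\<lambda>n. Finseq (map g [0..<n]))"
    have pre: "prefix (map g [0..<m]) (map g [0..<n])" if "m \<le> n" for m n
      using that by (metis le_Suc_ex map_append prefixI upt_add_eq_append zero_le)
    have "\<exists>z\<in>D. a \<le> z \<and> b \<le> z" if a: "a \<in> D" and b: "b \<in> D" for a b
    proof -
      obtain m n where "a = Finseq (map g [0..<m])" "b = Finseq (map g [0..<n])"
        using a b by (auto simp: D_def)
      then show ?thesis
        using pre[of m "max m n"] pre[of n "max m n"] by (auto simp: D_def)
    qed
    then have "directed D" by (auto simp: directed_def D_def)
    moreover have "\<exists>s. Finseq s \<in> D \<and> n < length s" for n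
      by (rule exI[of _ "map g [0..<Suc n]"]) (auto simp: D_def simp del: upt_Suc)
    then have "isLub UNIV D x"
      unfolding Infseq by (intro isLub_initial_segments) (auto simp: D_def T\<^sub>2_def)
    ultimately have "D \<inter> U \<noteq> {}" using U that unfolding scott_open_def by blast
    moreover have "d \<in> T\<^sub>2 \<and> d \<le> x" if "d \<in> D" for d
      using that Infseq by (auto simp: D_def T\<^sub>2_def)
    ultimately show ?thesis by blast
  qed
  then have "U = (\<Union>a\<in>U \<inter> T\<^sub>2. {a..})"
    using U unfolding scott_open_def by fastforce
  then show "\<exists>S\<subseteq>T\<^sub>2. U = (\<Union>a\<in>S. {a..})" by blast
next
  assume "\<exists>S\<subseteq>T\<^sub>2. U = (\<Union>a\<in>S. {a..})"
  then obtain S where S: "S \<subseteq> T\<^sub>2" "U = (\<Union>a\<in>S. {a..})" by blast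
  have "openin scott_topology (\<Union>a\<in>S. {a..})"
    using S(1) scott_open_up by (intro openin_Union) (auto simp del: atLeast_iff)
  with S show "scott_open U" by simp
qed

end

theory Submission
  imports Defs
begin

text \<open>
  The map onto \<open>L\<^sub>2\<close> is an itinerary map of symbolic dynamics. Iterate \<open>x \<mapsto> 2 tan x\<close> on the real
  line, emit the digit \<open>cos x < 0\<close> at each iteration, and stop when a pole \<open>cos x = 0\<close> is reached:
  points that fall onto a pole get a finite sequence, all others an infinite one. The digit is the
  parity of the cell \<open>(k \<pi> - \<pi>/2, k \<pi> + \<pi>/2)\<close> that contains \<open>x\<close>, and each such cell is mapped
  homeomorphically onto the whole line, with inverse \<open>y \<mapsto> k \<pi> + arctan (y/2)\<close>. Thus the itinerary
  map satisfies the recursion \<open>itinerary_branch\<close>, and continuity and surjectivity on the line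
  follow by pulling back along these branches.

  Openness has two ingredients. The factor 2 makes every inverse branch a contraction with
  constant 1/2, so that a point whose orbit avoids the poles for long lies in a tiny nested cell,
  which is mapped onto the up-set of a finite initial segment of its itinerary. A pole has a cell
  of each parity on its two sides; a one-sided neighbourhood of the pole corresponds, under the
  branch, to a half-line, and since the itinerary map is onto, periodic and even, it already maps every
  half-line onto \<open>L\<^sub>2\<close>. So each neighbourhood of a pole is mapped onto all of \<open>L\<^sub>2\<close>. Both cases
  are combined in \<open>itinerary_image_ball\<close>, by induction on the radius.

  To pass to an arbitrary interval, move it by a homeomorphism to an interval \<open>J\<close> with
  \<open>(0, \<pi>) \<subseteq> J \<subseteq> [0, \<pi>]\<close>. The itinerary map is symmetric about \<open>0\<close> and about \<open>\<pi>\<close>, so folding the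
  line at these two points does not change its values; hence a relatively open subset of \<open>J\<close>, even
  when it contains an end point, has the same image as an open subset of the line.
\<close>

section \<open>Prepending a digit\<close>

fun prepend :: "bool \<Rightarrow> L\<^sub>2 \<Rightarrow> L\<^sub>2" where
  "prepend d (Finseq s) = Finseq (d # s)"
| "prepend d (Infseq g) = Infseq (case_nat d g)"

lemma L2_cases_prepend:
  obtains "z = Finseq []" | d z' where "z = prepend d z'"
proof (cases z)
  case (Finseq s)
  with that show thesis by (cases s) (auto intro: that(2)[of _ "Finseq _"])
next
  case (Infseq g)
  have "g = case_nat (g 0) (\<lambda>n. g (Suc n))" by (auto simp: fun_eq_iff split: nat.split)
  with Infseq that(2)[of "g 0" "Infseq (\<lambda>n. g (Suc n))"] show thesis by simp
qed

lemma Finseq_Nil_le [simp]: "Finseq [] \<le> z"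
  by (cases z) auto

lemma Finseq_Cons_le_Nil [simp]: "\<not> Finseq (d # s) \<le> Finseq []"
  by auto

lemma Finseq_Cons_le_prepend [simp]:
  "Finseq (d # s) \<le> prepend e z \<longleftrightarrow> d = e \<and> Finseq s \<le> z"
proof (cases z)
  case (Infseq g)
  then show ?thesis by (auto simp: nth_Cons' gr0_conv_Suc All_less_Suc2)
qed auto

lemma up_Finseq_Cons: "{Finseq (d # s)..} = prepend d ` {Finseq s..}"
proof (intro equalityI subsetI)
  fix z assume "z \<in> {Finseq (d # s)..}"
  then show "z \<in> prepend d ` {Finseq s..}"
    by (cases z rule: L2_cases_prepend) auto
qed auto

text \<open>An infinite sequence is the supremum of its initial segments, and it is maximal.\<close>

lemma eq_Infseq_if_prefixes_le:
  assumes "\<And>n. Finseq (map g [0..<n]) \<le> z"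
  shows "z = Infseq g"
proof -
  have "isLub UNIV (range (\<lambda>n. Finseq (map g [0..<n]))) (Infseq g)"
    by (rule isLub_initial_segments)
      (auto simp: T\<^sub>2_def intro: exI[of _ "map g [0..<Suc _]"] simp del: upt_Suc)
  then have "Infseq g \<le> z" using assms by (auto simp: isLub_iff)
  then show ?thesis by (simp add: Infseq_le_iff)
qed

section \<open>The itinerary map\<close>

definition step :: "real \<Rightarrow> real" where
  "step x = 2 * tan x"

text \<open>
  Poles must be tested separately: the convention \<open>tan x = 0\<close> at a pole would let the orbit go on.
\<close>

definition itinerary :: "real \<Rightarrow> L\<^sub>2" where
  "itinerary x =
    (if \<exists>n. cos ((step ^^ n) x) = 0
     then Finseq (map (\<lambda>i. cos ((step ^^ i) x) < 0) [0..<LEAST n. cos ((step ^^ n) x) = 0])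
     else Infseq (\<lambda>i. cos ((step ^^ i) x) < 0))"

lemma itinerary_pole: "cos x = 0 \<Longrightarrow> itinerary x = Finseq []"
proof -
  assume x: "cos x = 0"
  then have "(LEAST n. cos ((step ^^ n) x) = 0) = 0" by (intro Least_equality) auto
  moreover have "\<exists>n. cos ((step ^^ n) x) = 0" using x by (intro exI[of _ 0]) simp
  ultimately show ?thesis by (simp add: itinerary_def)
qed

lemma itinerary_rec:
  assumes x: "cos x \<noteq> 0"
  shows "itinerary x = prepend (cos x < 0) (itinerary (step x))"
proof (cases "\<exists>n. cos ((step ^^ n) x) = 0")
  case True
  then obtain n where n: "cos ((step ^^ n) x) = 0" by blast
  have L: "(LEAST n. cos ((step ^^ n) x) = 0) = Suc (LEAST m. cos ((step ^^ Suc m) x) = 0)"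
    using n x by (intro Least_Suc) auto
  have "\<exists>m. cos ((step ^^ m) (step x)) = 0"
    using n x by (cases n) (auto simp: funpow_swap1)
  with True L show ?thesis
    by (simp add: itinerary_def map_upt_Suc funpow_swap1 del: upt_Suc)
next
  case False
  then have "cos ((step ^^ n) (step x)) \<noteq> 0" for n
    using False by (metis funpow_Suc_right comp_apply)
  with False show ?thesis
    by (auto simp: itinerary_def funpow_swap1 fun_eq_iff split: nat.split)
qed

lemma itinerary_minus [simp]: "itinerary (- x) = itinerary x"
proof -
  have "(step ^^ n) (- x) = - (step ^^ n) x" for n
    by (induction n) (auto simp: step_def)
  then show ?thesis by (simp add: itinerary_def)
qed

lemma itinerary_abs [simp]: "itinerary \<bar>x\<bar> = itinerary x"
  by (simp add: abs_if)

lemma itinerary_periodic: "itinerary (x + real n * (2 * pi)) = itinerary x"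
proof -
  have "sin (real n * (2 * pi)) = 0" "cos (real n * (2 * pi)) = 1"
    using sin_npi[of "2 * n"] cos_npi[of "2 * n"] by (simp_all add: mult_ac)
  then have "cos (x + real n * (2 * pi)) = cos x" "sin (x + real n * (2 * pi)) = sin x"
    by (simp_all add: cos_add sin_add)
  then show ?thesis
    by (cases "cos x = 0") (simp_all add: itinerary_pole itinerary_rec step_def tan_def)
qed

text \<open>
  Reading off one digit is continuous away from the poles, and the remaining digits are read at
  \<open>step x\<close>; so the set is an iterated preimage of open sets.
\<close>

lemma open_itinerary_vimage_up: "open {x. Finseq s \<le> itinerary x}"
proof (induction s)
  case (Cons d s)
  define D where "D = {x::real. cos x \<noteq> 0 \<and> (cos x < 0) = d}"
  have "D = (if d then {x. cos x < 0} else {x. 0 < cos x})" by (auto simp: D_def)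
  then have "open D" by (auto intro!: open_Collect_less continuous_intros)
  moreover have "continuous_on D step"
    unfolding step_def by (intro continuous_intros) (auto simp: D_def)
  ultimately have "open (D \<inter> step -` {x. Finseq s \<le> itinerary x})"
    using Cons by (intro continuous_open_preimage)
  moreover have "{x. Finseq (d # s) \<le> itinerary x} = D \<inter> step -` {x. Finseq s \<le> itinerary x}"
  proof -
    have "Finseq (d # s) \<le> itinerary x \<longleftrightarrow> x \<in> D \<and> Finseq s \<le> itinerary (step x)" for x
      by (cases "cos x = 0") (auto simp: itinerary_pole itinerary_rec D_def)
    then show ?thesis by auto
  qed
  ultimately show ?case by simp
qed simp

section \<open>Inverse branches\<close>

text \<open>
  The inverse of the restriction of \<^const>\<open>step\<close> to the cell \<open>(k \<pi> - \<pi>/2, k \<pi> + \<pi>/2)\<close>.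
\<close>

definition branch :: "int \<Rightarrow> real \<Rightarrow> real" where
  "branch k y = of_int k * pi + arctan (y / 2)"

lemma cos_branch: "cos (branch k y) = (if even k then 1 else -1) * cos (arctan (y / 2))"
  by (simp add: branch_def cos_add mult.commute[of _ pi])

lemma itinerary_branch: "itinerary (branch k y) = prepend (odd k) (itinerary y)"
proof -
  have "sin (branch k y) = (if even k then 1 else -1) * sin (arctan (y / 2))"
    by (simp add: branch_def sin_add mult.commute[of _ pi])
  then have "tan (branch k y) = tan (arctan (y / 2))"
    by (simp add: tan_def cos_branch)
  then have "step (branch k y) = y" by (simp add: step_def tan_arctan)
  moreover have "0 < cos (arctan (y / 2))" by (simp add: cos_arctan add_pos_nonneg)
  ultimately show ?thesis
    by (subst itinerary_rec) (auto simp: cos_branch)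
qed

lemma branch_step:
  assumes "cos x \<noteq> 0"
  obtains k where "x = branch k (step x)"
proof -
  obtain k where "arctan (tan x) = x - of_int k * pi"
    using arctan_tan_eq_abs_pi[OF assms] .
  then show thesis by (intro that[of k]) (simp add: branch_def step_def)
qed

lemma dist_branch_le: "\<bar>branch k y - branch k z\<bar> \<le> \<bar>y - z\<bar> / 2"
proof -
  have "norm (arctan (y/2) - arctan (z/2)) \<le> 1 * norm (y/2 - z/2)"
  proof (rule field_differentiable_bound[of UNIV])
    fix u :: real
    show "(arctan has_field_derivative inverse (1 + u\<^sup>2)) (at u within UNIV)"
      using DERIV_arctan by simp
    show "norm (inverse (1 + u\<^sup>2)) \<le> 1"
      by (simp add: inverse_le_1_iff)
  qed auto
  then show ?thesis unfolding branch_def real_norm_def by argo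
qed

lemma dist_branch_less_pi: "\<bar>branch k y - branch k z\<bar> < pi"
  using arctan_bounded[of "y/2"] arctan_bounded[of "z/2"] unfolding branch_def by linarith

lemma continuous_on_branch: "continuous_on A (branch k)"
  unfolding branch_def by (intro continuous_intros) auto

section \<open>Surjectivity\<close>

text \<open>
  An infinite sequence is realised as an itinerary by a compactness argument. The base interval
  is chosen so large that the branches 0 and 1, whose values lie between \<open>- \<pi>/2\<close> and \<open>3 \<pi>/2\<close>,
  map it into itself; this makes the cylinders shrink when the sequence is extended.
\<close>

primrec cylinder :: "bool list \<Rightarrow> real set" where
  "cylinder [] = {- 2 * pi..2 * pi}"
| "cylinder (d # s) = branch (of_bool d) ` cylinder s"

lemma compact_cylinder: "compact (cylinder s)"
  by (induction s) (auto intro: compact_continuous_image continuous_on_branch)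

lemma cylinder_nonempty: "cylinder s \<noteq> {}"
  by (induction s) auto

lemma cylinder_snoc_subset: "cylinder (s @ [d]) \<subseteq> cylinder s"
proof (induction s)
  case Nil
  have "branch (of_bool d) y \<in> {- 2 * pi..2 * pi}" for y
    using arctan_bounded[of "y/2"] pi_gt_zero by (cases d) (auto simp: branch_def)
  then show ?case by auto
qed (auto simp: image_iff)

lemma le_itinerary_cylinder: "x \<in> cylinder s \<Longrightarrow> Finseq s \<le> itinerary x"
  by (induction s arbitrary: x) (auto simp: itinerary_branch)

lemma surj_itinerary: "surj itinerary"
proof -
  have "\<exists>x. itinerary x = z" for z
  proof (cases z)
    case (Finseq s)
    have "\<exists>x. itinerary x = Finseq s"
    proof (induction s)
      case Nil
      show ?case by (rule exI[of _ "pi/2"]) (simp add: itinerary_pole)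
    next
      case (Cons d s)
      then obtain y where "itinerary y = Finseq s" ..
      then show ?case by (intro exI[of _ "branch (of_bool d) y"]) (simp add: itinerary_branch)
    qed
    with Finseq show ?thesis by simp
  next
    case (Infseq g)
    define C where "C n = cylinder (map g [0..<n])" for n
    have "decseq C" using cylinder_snoc_subset by (intro decseq_SucI) (auto simp: C_def)
    then have "(\<Inter>n. C n) \<noteq> {}"
      by (intro compact_nest) (auto simp: C_def compact_cylinder cylinder_nonempty decseq_def)
    then obtain x where "\<And>n. x \<in> C n" by blast
    then have "itinerary x = Infseq g"
      by (intro eq_Infseq_if_prefixes_le) (auto simp: C_def le_itinerary_cylinder simp del: upt_Suc)
    with Infseq show ?thesis by blast
  qed
  then show ?thesis by (metis surjI)
qed

section \<open>Openness\<close>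

text \<open>By periodicity every value is taken arbitrarily far to the right.\<close>

lemma itinerary_half_line: "itinerary ` {M<..} = UNIV"
proof -
  have "z \<in> itinerary ` {M<..}" for z
  proof -
    obtain x where x: "itinerary x = z" using surj_itinerary by (metis surjD)
    obtain n where "M - x < real n * (2 * pi)"
      using ex_less_of_nat_mult[of "2 * pi" "M - x"] by auto
    with x show ?thesis
      by (intro image_eqI[of _ _ "x + real n * (2 * pi)"]) (auto simp: itinerary_periodic)
  qed
  then show ?thesis by auto
qed

text \<open>
  Just left of the pole \<open>k \<pi> + \<pi>/2\<close> are the points \<open>branch k y\<close> for large \<open>y\<close>, and just right of it
  the points \<open>branch (k + 1) (- y)\<close> for large \<open>y\<close>. One of \<open>k\<close> and \<open>k + 1\<close> has the parity of the
  first digit wanted. The remaining digits are those of \<open>y\<close>, which ranges over a half-line; the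
  sign of \<open>- y\<close> does not matter because the itinerary map is even.
\<close>

lemma itinerary_image_nbhd_pole:
  assumes x: "cos x = 0" and V: "open V" "x \<in> V"
  shows "itinerary ` V = UNIV"
proof -
  obtain k :: int where k: "x = of_int k * pi + pi/2"
    using x cos_zero_iff_int2 by auto
  have "LIM y at_top. (1 / 2) * y :> (at_top :: real filter)"
    by (rule filterlim_tendsto_pos_mult_at_top[OF tendsto_const]) (auto intro: filterlim_ident)
  then have arctan_half: "((\<lambda>y. arctan (y / 2)) \<longlongrightarrow> pi / 2) at_top"
    using filterlim_compose[OF tendsto_arctan_at_top] by simp
  have "((\<lambda>y. branch k y) \<longlongrightarrow> of_int k * pi + pi/2) at_top"
    unfolding branch_def by (intro tendsto_intros arctan_half)
  then have "\<forall>\<^sub>F y in at_top. branch k y \<in> V"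
    using V k by (auto simp: tendsto_def)
  then obtain M where M: "\<And>y. y > M \<Longrightarrow> branch k y \<in> V"
    by (auto simp: eventually_at_top_dense)
  have "((\<lambda>y. branch (k + 1) (- y)) \<longlongrightarrow> of_int (k + 1) * pi - pi/2) at_top"
    unfolding branch_def minus_divide_left[symmetric] arctan_minus diff_conv_add_uminus
    by (intro tendsto_intros arctan_half)
  then have "((\<lambda>y. branch (k + 1) (- y)) \<longlongrightarrow> x) at_top"
    using k by (simp add: algebra_simps)
  then have "\<forall>\<^sub>F y in at_top. branch (k + 1) (- y) \<in> V"
    using V by (auto simp: tendsto_def)
  then obtain N where N: "\<And>y. y > N \<Longrightarrow> branch (k + 1) (- y) \<in> V"
    by (auto simp: eventually_at_top_dense)
  have "z \<in> itinerary ` V" for z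
  proof (cases z rule: L2_cases_prepend)
    case 1
    with x V show ?thesis by (auto simp: itinerary_pole intro!: image_eqI[of _ _ x])
  next
    case (2 d z')
    show ?thesis
    proof (cases "odd k = d")
      case True
      obtain y where "y > M" "itinerary y = z'"
        using itinerary_half_line[of M] by (metis UNIV_I greaterThan_iff imageE)
      with True 2 M show ?thesis
        by (intro image_eqI[of _ _ "branch k y"]) (auto simp: itinerary_branch)
    next
      case False
      obtain y where "y > N" "itinerary y = z'"
        using itinerary_half_line[of N] by (metis UNIV_I greaterThan_iff imageE)
      with False 2 N show ?thesis
        by (intro image_eqI[of _ _ "branch (k + 1) (- y)"]) (auto simp: itinerary_branch)
    qed
  qed
  then show ?thesis by auto
qed

text \<open>
  A ball of radius \<open>\<pi>\<close> contains the whole cell of its centre, which is mapped onto the up-set of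
  one digit. Since branches halve distances, the ball of half the radius about \<open>x\<close> contains the
  image under a branch of the ball about \<open>step x\<close>, which costs one further digit. The recursion
  ends early when the orbit meets a pole.
\<close>

lemma itinerary_image_ball:
  "\<exists>s. Finseq s \<le> itinerary x \<and> {Finseq s..} \<subseteq> itinerary ` ball x (pi / 2 ^ n)"
proof (induction n arbitrary: x)
  case 0
  show ?case
  proof (cases "cos x = 0")
    case True
    then show ?thesis
      using itinerary_image_nbhd_pole[of x "ball x pi"] by (intro exI[of _ "[]"]) auto
  next
    case False
    then obtain k where k: "x = branch k (step x)" by (rule branch_step)
    have "branch k y \<in> ball x pi" for y
      using dist_branch_less_pi[of k "step x" y] k by (simp add: dist_real_def)
    then have "prepend (odd k) (itinerary y) \<in> itinerary ` ball x pi" for y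
      by (metis itinerary_branch imageI)
    then have "prepend (odd k) z \<in> itinerary ` ball x pi" for z
      by (metis surj_itinerary surjD)
    then have "{Finseq [odd k]..} \<subseteq> itinerary ` ball x pi"
      by (auto simp: up_Finseq_Cons)
    moreover have "Finseq [odd k] \<le> itinerary x"
      using k itinerary_branch[of k "step x"] by simp
    ultimately show ?thesis by auto
  qed
next
  case (Suc n)
  show ?case
  proof (cases "cos x = 0")
    case True
    then show ?thesis
      using itinerary_image_nbhd_pole[of x "ball x (pi / 2 ^ Suc n)"]
      by (intro exI[of _ "[]"]) auto
  next
    case False
    then obtain k where k: "x = branch k (step x)" by (rule branch_step)
    obtain s where s: "Finseq s \<le> itinerary (step x)"
      "{Finseq s..} \<subseteq> itinerary ` ball (step x) (pi / 2 ^ n)"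
      using Suc by blast
    have "branch k y \<in> ball x (pi / 2 ^ Suc n)" if "y \<in> ball (step x) (pi / 2 ^ n)" for y
      using dist_branch_le[of k "step x" y] k that by (simp add: dist_real_def)
    then have "prepend (odd k) ` itinerary ` ball (step x) (pi / 2 ^ n)
        \<subseteq> itinerary ` ball x (pi / 2 ^ Suc n)"
      by (force simp: itinerary_branch[symmetric])
    then have "{Finseq (odd k # s)..} \<subseteq> itinerary ` ball x (pi / 2 ^ Suc n)"
      unfolding up_Finseq_Cons using s(2) by blast
    moreover have "Finseq (odd k # s) \<le> itinerary x"
      using k s(1) itinerary_branch[of k "step x"] by simp
    ultimately show ?thesis by blast
  qed
qed

lemma scott_open_itinerary_image:
  assumes "open V"
  shows "scott_open (itinerary ` V)"
proof -
  define S where "S = {a \<in> T\<^sub>2. {a..} \<subseteq> itinerary ` V}"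
  have "\<exists>a\<in>S. itinerary x \<in> {a..}" if x: "x \<in> V" for x
  proof -
    obtain e where e: "e > 0" "ball x e \<subseteq> V" using assms x by (meson open_contains_ball)
    obtain n where "pi / e < 2 ^ n" using real_arch_pow[of 2 "pi / e"] by auto
    with e have "pi / 2 ^ n < e" by (simp add: field_simps)
    then have "ball x (pi / 2 ^ n) \<subseteq> V" using e by (meson less_imp_le order_trans subset_ball)
    moreover obtain s where "Finseq s \<le> itinerary x"
      "{Finseq s..} \<subseteq> itinerary ` ball x (pi / 2 ^ n)" using itinerary_image_ball by blast
    ultimately have "Finseq s \<in> S" "itinerary x \<in> {Finseq s..}"
      unfolding S_def T\<^sub>2_def by blast+
    then show ?thesis ..
  qed
  then have "itinerary ` V = (\<Union>a\<in>S. {a..})" by (auto simp: S_def)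
  moreover have "S \<subseteq> T\<^sub>2" by (auto simp: S_def)
  ultimately show ?thesis unfolding scott_open_basis by blast
qed

lemma open_itinerary_vimage:
  assumes "scott_open U"
  shows "open (itinerary -` U)"
proof -
  obtain S where S: "S \<subseteq> T\<^sub>2" "U = (\<Union>a\<in>S. {a..})" using assms scott_open_basis by auto
  then have "itinerary -` U = (\<Union>a\<in>S. {x. a \<le> itinerary x})" by auto
  moreover have "open {x. a \<le> itinerary x}" if "a \<in> S" for a
    using that S open_itinerary_vimage_up by (auto simp: T\<^sub>2_def)
  ultimately show ?thesis by auto
qed

section \<open>Restriction to intervals\<close>

text \<open>
  On \<open>[- 2 \<pi>, 2 \<pi>]\<close> this retracts onto \<open>[0, \<pi>]\<close> by reflecting at \<open>0\<close> and at \<open>\<pi>\<close>.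
\<close>

definition fold_map :: "real \<Rightarrow> real" where
  "fold_map x = pi - \<bar>\<bar>x\<bar> - pi\<bar>"

lemma itinerary_fold_map: "itinerary (fold_map x) = itinerary x"
proof -
  have refl: "itinerary (2 * pi - u) = itinerary u" for u
    using itinerary_periodic[of "- u" 1] by (simp add: add.commute)
  have "fold_map x = (if \<bar>x\<bar> \<le> pi then \<bar>x\<bar> else 2 * pi - \<bar>x\<bar>)"
    by (auto simp: fold_map_def)
  then show ?thesis by (simp add: refl)
qed

text \<open>
  A relatively open subset \<open>W\<close> of \<open>J\<close> is relatively open in \<open>[0, \<pi>]\<close>. Its preimage under the
  folding, taken within a neighbourhood of \<open>[0, \<pi>]\<close> that folds into \<open>[0, \<pi>]\<close>, is open in the line, and has the same
  image under the itinerary map as \<open>W\<close>.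
\<close>

lemma interior_map_itinerary_interval:
  assumes J: "{0<..<pi} \<subseteq> J" "J \<subseteq> {0..pi}"
  shows "interior_map (top_of_set J) scott_topology itinerary \<and> itinerary ` J = UNIV"
proof -
  have image: "\<exists>W'. open W' \<and> itinerary ` W' = itinerary ` W"
    if W: "openin (top_of_set J) W" for W
  proof -
    obtain V where V: "open V" "W = J \<inter> V" using W by (auto simp: openin_open)
    \<comment> \<open>removing the end points outside \<open>J\<close> makes \<open>W\<close> the trace of \<open>V'\<close> on \<open>[0, \<pi>]\<close>\<close>
    define V' where "V' = V - ({0, pi} - J)"
    have V': "open V'" unfolding V'_def using V by (intro open_Diff finite_imp_closed) auto
    have "{0..pi} \<inter> V' \<subseteq> J"
    proof
      fix x assume "x \<in> {0..pi} \<inter> V'"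
      then show "x \<in> J" using J(1) by (cases "x = 0 \<or> x = pi") (auto simp: V'_def)
    qed
    then have WV': "W = {0..pi} \<inter> V'" using V J(2) by (auto simp: V'_def)
    define W' where "W' = {- pi<..<2 * pi} \<inter> fold_map -` V'"
    have W'_eq: "W' = {x \<in> {- pi<..<2 * pi}. fold_map x \<in> W}"
      by (auto simp: W'_def WV' fold_map_def)
    have "open W'"
      unfolding W'_def fold_map_def using V'
      by (intro open_Int open_vimage continuous_intros) auto
    moreover have "itinerary ` W' = itinerary ` W"
    proof (intro equalityI subsetI)
      fix z assume "z \<in> itinerary ` W'"
      then obtain x where "z = itinerary (fold_map x)" "fold_map x \<in> W"
        by (auto simp: W'_eq itinerary_fold_map)
      then show "z \<in> itinerary ` W" by blast
    next
      fix z assume "z \<in> itinerary ` W"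
      then obtain x where x: "z = itinerary x" "x \<in> W" by blast
      then have "x \<in> {0..pi}" by (auto simp: WV')
      then have "fold_map x = x" "x \<in> {- pi<..<2 * pi}"
        using pi_gt_zero by (auto simp: fold_map_def simp del: pi_gt_zero)
      with x show "z \<in> itinerary ` W'" by (auto simp: W'_eq)
    qed
    ultimately show ?thesis by blast
  qed
  have "open_map (top_of_set J) scott_topology itinerary"
    unfolding open_map_def using image scott_open_itinerary_image by (metis openin_scott_topology)
  moreover have "continuous_map (top_of_set J) scott_topology itinerary"
    using open_itinerary_vimage
    by (auto simp: continuous_map_def openin_open vimage_def)
  moreover have "itinerary ` J = UNIV"
  proof -
    have "itinerary ` {0<..<pi} = UNIV"
      \<comment> \<open>the open interval is a neighbourhood of the pole \<open>\<pi>/2\<close>\<close>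
      by (rule itinerary_image_nbhd_pole[of "pi / 2"]) auto
    with J(1) show ?thesis by blast
  qed
  ultimately show ?thesis by (simp add: interior_map_def)
qed

text \<open>
  The arctangent makes the interval bounded, and an affine map then moves its end points to \<open>0\<close> and
  \<open>\<pi>\<close>; this treats bounded and unbounded intervals alike.
\<close>

lemma homeomorphism_to_standard_interval:
  fixes I :: "real set"
  assumes I: "is_interval I" "\<exists>x\<in>I. \<exists>y\<in>I. x \<noteq> y"
  obtains J g h where "homeomorphism I J g h" "{0<..<pi} \<subseteq> J" "J \<subseteq> {0..pi}"
proof -
  define K where "K = arctan ` I"
  define a b where "a = Inf K" and "b = Sup K"
  have bdd: "bdd_below K" "bdd_above K"
    unfolding K_def using arctan_bounded
    by (intro bdd_belowI2[of _ "- (pi/2)"] bdd_aboveI2[of _ _ "pi/2"] less_imp_le; simp)+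
  have "K \<noteq> {}" using I by (auto simp: K_def)
  have ab: "a \<le> v" "v \<le> b" if "v \<in> K" for v
    using that bdd by (auto simp: a_def b_def intro: cInf_lower cSup_upper)
  obtain x y where xy: "x \<in> I" "y \<in> I" "x < y" using I(2) by (metis linorder_neqE)
  then have "a \<le> arctan x" "arctan x < arctan y" "arctan y \<le> b"
    using ab by (auto simp: K_def arctan_less_iff)
  then have "a < b" by linarith
  have K: "is_interval K"
    unfolding K_def using I(1)
    by (simp add: is_interval_connected_1 connected_continuous_image continuous_on_arctan)
  define g where "g x = pi * (arctan x - a) / (b - a)" for x
  define h where "h y = tan (a + (b - a) * y / pi)" for y
  have inv: "a + (b - a) * g x / pi = arctan x" for x
    using \<open>a < b\<close> by (simp add: g_def)
  have "homeomorphism I (g ` I) g h"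
  proof (rule homeomorphismI)
    show "continuous_on I g"
      unfolding g_def using \<open>a < b\<close> by (intro continuous_intros) auto
    show "continuous_on (g ` I) h"
      unfolding h_def by (intro continuous_intros) (auto simp: inv)
    show "h (g x) = x" for x by (simp add: h_def inv tan_arctan)
    then show "h ` g ` I \<subseteq> I" "y \<in> g ` I \<Longrightarrow> g (h y) = y" for y by auto
  qed auto
  moreover have "{0<..<pi} \<subseteq> g ` I"
  proof
    fix y assume y: "y \<in> {0<..<pi}"
    define v where "v = a + (b - a) * y / pi"
    have "(b - a) * y < (b - a) * pi" using \<open>a < b\<close> y by auto
    then have "a < v" "v < b" using \<open>a < b\<close> y by (auto simp: v_def field_simps)
    obtain p q where "p \<in> K" "p < v" "q \<in> K" "v < q"
      using \<open>a < v\<close> \<open>v < b\<close> \<open>K \<noteq> {}\<close> bdd cInf_lessD less_cSupD unfolding a_def b_def by meson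
    then have "v \<in> K" using K by (meson is_interval_1 less_imp_le)
    then obtain x where "x \<in> I" "v = arctan x" by (auto simp: K_def)
    moreover have "y = pi * (v - a) / (b - a)" using \<open>a < b\<close> by (simp add: v_def)
    ultimately show "y \<in> g ` I" by (auto simp: g_def)
  qed
  moreover have "g ` I \<subseteq> {0..pi}"
  proof -
    have "a \<le> arctan x" "arctan x \<le> b" if "x \<in> I" for x
      using ab that by (auto simp: K_def)
    then show ?thesis using \<open>a < b\<close> by (auto simp: g_def field_simps)
  qed
  ultimately show thesis by (rule that)
qed

theorem theorem8p5:
  fixes I :: "real set"
  assumes "is_interval I" and "\<exists>x\<in>I. \<exists>y\<in>I. x \<noteq> y"
  shows "\<exists>f :: real \<Rightarrow> L\<^sub>2.
           interior_map (top_of_set I) scott_topology f \<and> f ` I = UNIV"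
proof -
  obtain J g h where gh: "homeomorphism I J g h" and J: "{0<..<pi} \<subseteq> J" "J \<subseteq> {0..pi}"
    using homeomorphism_to_standard_interval[OF assms] .
  have it: "interior_map (top_of_set J) scott_topology itinerary" "itinerary ` J = UNIV"
    using interior_map_itinerary_interval[OF J] by auto
  have "homeomorphic_map (top_of_set I) (top_of_set J) g"
    unfolding homeomorphic_map_maps using gh
    by (intro exI[of _ h]) (auto simp: homeomorphic_maps_def homeomorphism_def)
  then have "interior_map (top_of_set I) scott_topology (itinerary \<circ> g)"
    using it(1) unfolding interior_map_def
    by (metis continuous_map_compose homeomorphic_eq_everything_map open_map_compose)
  moreover have "(itinerary \<circ> g) ` I = UNIV"
    using it(2) homeomorphism_image1[OF gh] by (simp only: image_comp[symmetric])
  ultimately show ?thesis by blast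
qed

end
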